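(* Let $N$ be a positive integer. Then $${}_{12}\phi_{11}\left[\begin{matrix}k,\,q\sqrt{k},\,-q\sqrt{k},\,y,\,z,\,\frac{qa}{k},\,\frac{k}{\sqrt{a}},\,-\frac{k}{\sqrt{a}},\,k\sqrt{\frac{q}{a}},\,-k\sqrt{\frac{q}{a}},\,\frac{kaq^{N+1}}{yz},\,q^{-N}\\ \sqrt{k},\,-\sqrt{k},\,\frac{qk}{y},\,\frac{qk}{z},\,\frac{k^2}{a},\,\sqrt{aq},\,-\sqrt{aq},\,q\sqrt{a},\,-q\sqrt{a},\,kq^{N+1},\,\frac{yzq^{-N}}{a}\end{matrix};q,q\right]$$ $$=\frac{(kq,\,kq/(yz),\,aq/y,\,aq/z;q)_N}{(kq/y,\,kq/z,\,aq/(yz),\,aq;q)_N}\;{}_{5}\phi_{4}\left[\begin{matrix}y,\,z,\,\frac{qa^2}{k^2},\,\frac{kaq^{N+1}}{yz},\,q^{-N}\\ \frac{qa}{y},\,\frac{qa}{z},\,aq^{N+1},\,\frac{yzq^{-N}}{k}\end{matrix};q,q\right].$$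
   Context: For an integer $n\ge 0$, $(x;q)_n=\prod_{i=0}^{n-1}(1-xq^i)$ and $(x_1,\dots,x_m;q)_n=\prod_{j=1}^m(x_j;q)_n$. The basic hypergeometric series is ${}_{r+1}\phi_r\left[\begin{matrix}a_1,\dots,a_{r+1}\\ b_1,\dots,b_r\end{matrix};q,x\right]=\sum_{n\ge0}\frac{(a_1,\dots,a_{r+1};q)_n}{(q,b_1,\dots,b_r;q)_n}x^n$; when $q^{-N}$ is an upper parameter the series terminates, and the sum is over $0\le n\le N$. Here $q,a,k,y,z$ are nonzero complex numbers such that none of the denominators vanish; all square roots are fixed choices. *)

theory Defs
  imports Complex_Main
begin

definition qpoch :: "complex \<Rightarrow> complex \<Rightarrow> nat \<Rightarrow> complex" where
  "qpoch x q n = (\<Prod>i<n. 1 - x * q ^ i)"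

definition qpochs :: "complex list \<Rightarrow> complex \<Rightarrow> nat \<Rightarrow> complex" where
  "qpochs xs q n = (\<Prod>x\<leftarrow>xs. qpoch x q n)"

(* Intended for length as = length bs + 1. *)
definition qhyp :: "complex list \<Rightarrow> complex list \<Rightarrow> complex \<Rightarrow> complex \<Rightarrow> complex" where
  "qhyp as bs q x = (\<Sum>n. qpochs as q n / qpochs (q # bs) q n * x ^ n)"

(* For n > N the numerators vanish, so these terms are 0 even where a lower
   parameter makes the denominator vanish (division by zero gives 0). *)
lemma qhyp_terminating:
  assumes "q \<noteq> 0" and "q powi (- int N) \<in> set as"
  shows "qhyp as bs q x = (\<Sum>n\<le>N. qpochs as q n / qpochs (q # bs) q n * x ^ n)"
  unfolding qhyp_def
proof (rule suminf_finite)
  fix n assume "n \<notin> {..N}"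
  hence "N < n" by simp
  have "1 - q powi (- int N) * q ^ N = 0"
    using assms(1) by (simp add: power_int_minus)
  hence "qpoch (q powi (- int N)) q n = 0"
    unfolding qpoch_def using \<open>N < n\<close> by (intro prod_zero) auto
  hence "qpochs as q n = 0"
    unfolding qpochs_def using assms(2) by (force simp: prod_list_zero_iff)
  thus "qpochs as q n / qpochs (q # bs) q n * x ^ n = 0" by simp
qed simp

end

theory Submission
  imports Defs
begin

text \<open>The left-hand side is well-poised in \<open>k\<close>, the right-hand side in \<open>a\<close>, and the two are related by
  a WP-Bailey pair. After merging the square-root parameters, the left-hand summand is \<open>W n * \<beta> n\<close>,
  where the q-Saalschuetz sum gives
  \<open>\<beta> n = (\<Sum>r\<le>n. (k/a)\<^bsub>n-r\<^esub> (k)\<^bsub>n+r\<^esub> / ((q)\<^bsub>n-r\<^esub> (aq)\<^bsub>n+r\<^esub>) * \<alpha> r)\<close> with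
  \<open>\<alpha> r = (q a\<^sup>2 / k\<^sup>2)\<^bsub>r\<^esub> / (q)\<^bsub>r\<^esub> * (k/a)\<^sup>r\<close>. Exchanging the sums, the inner sum over \<open>n\<close> is Jackson's
  terminating very-well-poised 8-phi-7 sum with base \<open>k q\<^bsup>2r\<^esup>\<close>, and what remains is the balanced
  5-phi-4 series. Both summation formulas are proved by creative telescoping in the length of the sum.\<close>

subsection \<open>Shifted factorials\<close>

lemma qpoch_0 [simp]: "qpoch x q 0 = 1"
  by (simp add: qpoch_def)

lemma qpoch_Suc: "qpoch x q (Suc n) = qpoch x q n * (1 - x * q ^ n)"
  by (simp add: qpoch_def)

lemma qpoch_add: "qpoch x q (m + n) = qpoch x q m * qpoch (x * q ^ m) q n"
  by (induction n) (simp_all add: qpoch_Suc power_add mult_ac)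

lemma qpoch_Suc_shift: "qpoch x q (Suc n) = (1 - x) * qpoch (x * q) q n"
  using qpoch_add[of x q 1 n] by (simp add: qpoch_Suc)

text \<open>An initial product divides the whole one. This fact and the next two pass from one
  nonvanishing factorial to its prefixes, its single factors and its inner blocks.\<close>

lemma qpoch_nonzero_mono: "qpoch x q n \<noteq> 0 \<Longrightarrow> m \<le> n \<Longrightarrow> qpoch x q m \<noteq> 0"
  by (metis le_Suc_ex mult_zero_left qpoch_add)

lemma qpoch_nonzero_factor: "qpoch x q n \<noteq> 0 \<Longrightarrow> m < n \<Longrightarrow> x * q ^ m \<noteq> 1"
  using qpoch_nonzero_mono[of x q n "Suc m"] by (auto simp: qpoch_Suc)

lemma qpoch_nonzero_shift: "qpoch x q n \<noteq> 0 \<Longrightarrow> m + l \<le> n \<Longrightarrow> qpoch (x * q ^ m) q l \<noteq> 0"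
  using qpoch_nonzero_mono[of x q n "m + l"] by (simp add: qpoch_add)

text \<open>The last \<open>r\<close> factors are turned around by
  \<open>1 - c = - c * (1 - 1/c)\<close> with \<open>c = x * q ^ (n - 1 - i)\<close>. This relates
  lower parameters containing \<open>1 / q ^ N\<close> to factorials such as
  \<open>qpoch (a*q/(y*z)) q N\<close>.\<close>

lemma qpoch_reverse:
  assumes "x \<noteq> 0" "q \<noteq> 0" "r \<le> n"
  shows "qpoch x q n = qpoch x q (n - r) * qpoch (q / (x * q ^ n)) q r * ((- x) ^ r * (\<Prod>i<r. q ^ (n - Suc i)))"
  using assms(3)
proof (induction r)
  case 0
  show ?case by simp
next
  case (Suc r)
  define m where "m = n - Suc r"
  have n: "n - r = Suc m" "n = Suc (r + m)" using Suc.prems by (auto simp: m_def)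
  have "q / (x * q ^ n) * q ^ r = 1 / (x * q ^ m)"
    using assms by (simp add: n(2) power_add)
  hence "1 - x * q ^ m = (1 - q / (x * q ^ n) * q ^ r) * (- x * q ^ m)"
    using assms by (simp add: field_simps)
  thus ?case
    using Suc unfolding n(1) m_def[symmetric] qpoch_Suc by (simp add: m_def mult_ac)
qed

text \<open>Factors of opposite sign multiply to a difference of squares, so the root disappears in
  base \<open>q^2\<close>. Two such pairs, with squares \<open>x\<close> and \<open>x * q\<close>,
  combine by \<open>qpoch_double\<close> into one factorial of length \<open>2 * n\<close>.\<close>

lemma qpoch_sqrt_pair: "qpoch s q n * qpoch (- s) q n = qpoch (s\<^sup>2) (q\<^sup>2) n"
proof (induction n)
  case (Suc n)
  have "(1 - s * q ^ n) * (1 - (- s) * q ^ n) = 1 - s\<^sup>2 * (q\<^sup>2) ^ n"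
    by (simp add: power_mult[symmetric] mult.commute[of 2] power_mult power2_eq_square algebra_simps)
  thus ?case unfolding qpoch_Suc Suc[symmetric] by (simp only: mult_ac)
qed simp

lemma qpoch_double: "qpoch x q (2 * n) = qpoch x (q\<^sup>2) n * qpoch (x * q) (q\<^sup>2) n"
proof (induction n)
  case (Suc n)
  have "qpoch x q (2 * Suc n) = qpoch x q (2 * n) * (1 - x * (q\<^sup>2) ^ n) * (1 - x * (q * (q\<^sup>2) ^ n))"
    unfolding power_mult[symmetric] by (simp add: qpoch_Suc)
  thus ?case unfolding Suc qpoch_Suc by (simp only: mult_ac)
qed simp

subsection \<open>The q-Saalschuetz sum\<close>

text \<open>Written with \<open>(D)\<^bsub>n-j\<^esub> / (q)\<^bsub>n-j\<^esub>\<close> instead of \<open>(q\<^bsup>-n\<^esup>)\<^bsub>j\<^esub> / (q\<^bsup>1-n\<^esup>/D)\<^bsub>j\<^esub>\<close>, so that no condition on \<open>D\<close>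
  is needed.\<close>
lemma q_saalschuetz:
  assumes "A \<noteq> 0" "B \<noteq> 0" "qpoch q q n \<noteq> 0" "qpoch C q n \<noteq> 0" and D: "D * A * B = C"
  shows "(\<Sum>j\<le>n. qpoch A q j * qpoch B q j / (qpoch q q j * qpoch C q j)
            * (qpoch D q (n - j) / qpoch q q (n - j)) * D ^ j)
         = qpoch (D * B) q n * qpoch (D * A) q n / (qpoch q q n * qpoch C q n)"
  using assms(3,4)
proof (induction n)
  case 0
  show ?case by simp
next
  case (Suc n)
  define t where "t j = qpoch A q j * qpoch B q j / (qpoch q q j * qpoch C q j) * D ^ j" for j
  define s where "s i = qpoch D q i / qpoch q q i" for i
  \<comment> \<open>\<open>?Q / ?P\<close> is the quotient of the claimed values at
    \<open>Suc n\<close> and \<open>n\<close>; hence it suffices that \<open>?P\<close> times the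
    longer sum equals \<open>?Q\<close> times the shorter one.\<close>
  let ?P = "(1 - q ^ Suc n) * (1 - C * q ^ n)" and ?Q = "(1 - D * A * q ^ n) * (1 - D * B * q ^ n)"
  note nz = Suc.prems
  have P: "1 - q ^ Suc n \<noteq> 0" "1 - C * q ^ n \<noteq> 0" "qpoch q q n \<noteq> 0" "qpoch C q n \<noteq> 0"
    using nz by (auto simp: qpoch_Suc)
  have IH: "(\<Sum>j\<le>n. t j * s (n - j)) = qpoch (D * B) q n * qpoch (D * A) q n / (qpoch q q n * qpoch C q n)"
    using Suc.IH P by (simp add: t_def s_def mult_ac)
  \<comment> \<open>Closed form of the partial sums of the difference. At \<open>m = n\<close> it is
    the negative of \<open>?P * t (Suc n) * s 0\<close>, the one term of the longer sum without a
    partner.\<close>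
  have tel: "(\<Sum>j\<le>m. t j * (?P * s (Suc n - j) - ?Q * s (n - j)))
      = - (q ^ (n - m) * D ^ Suc m * qpoch A q (Suc m) * qpoch B q (Suc m)
           / (qpoch q q m * qpoch C q m) * s (n - m))" if "m \<le> n" for m
    using that
  proof (induction m)
    case 0
    have "qpoch D q (Suc n) / qpoch q q (Suc n) * ?P = s n * ((1 - D * q ^ n) * (1 - C * q ^ n))"
      using P by (simp add: s_def qpoch_Suc field_simps)
    thus ?case
      by (simp add: t_def s_def qpoch_Suc D[symmetric] algebra_simps)
  next
    case (Suc m)
    define i where "i = n - Suc m"
    have n: "n = Suc (m + i)" "n - m = Suc i" "Suc n - Suc m = Suc i" "n - Suc m = i"
      using Suc.prems by (auto simp: i_def)
    have nz': "1 - q ^ Suc m \<noteq> 0" "1 - C * q ^ m \<noteq> 0" "qpoch q q m \<noteq> 0" "qpoch C q m \<noteq> 0"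
      "1 - q ^ Suc i \<noteq> 0" "qpoch q q i \<noteq> 0"
      using qpoch_nonzero_mono[OF nz(1), of "Suc m"] qpoch_nonzero_mono[OF nz(2), of "Suc m"]
        qpoch_nonzero_mono[OF nz(1), of "Suc i"] n(1) by (simp_all add: qpoch_Suc)
    define c where "c = D ^ Suc m * qpoch A q (Suc m) * qpoch B q (Suc m)
        / (qpoch q q m * qpoch C q m) * s i"
    define u v where "u = q ^ i" and "v = q ^ m"
    have qn: "q ^ n = q * u * v" by (simp add: n u_def v_def power_add)
    have nz2: "1 - q * v \<noteq> 0" "1 - C * v \<noteq> 0" "1 - q * u \<noteq> 0" using nz' by (auto simp: u_def v_def)
    have si: "s (Suc i) = s i * (1 - D * u) / (1 - q * u)"
      by (simp add: s_def qpoch_Suc u_def)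
    have ts: "t (Suc m) * s i = c / ((1 - q * v) * (1 - C * v))"
      unfolding c_def t_def qpoch_Suc[of q] qpoch_Suc[of C] v_def by (simp add: mult_ac)
    have "x * (p * (y * d / e) - r * y) = x * y * (p * d / e - r)" for x y p r d e :: complex
      by (simp add: right_diff_distrib mult_ac)
    hence e1: "t (Suc m) * (?P * s (Suc n - Suc m) - ?Q * s (n - Suc m))
      = c / ((1 - q * v) * (1 - C * v)) * (?P * (1 - D * u) / (1 - q * u) - ?Q)"
      unfolding n(3,4) si ts[symmetric] .
    have e2: "- (q ^ (n - m) * D ^ Suc m * qpoch A q (Suc m) * qpoch B q (Suc m)
           / (qpoch q q m * qpoch C q m) * s (n - m)) = - c * q * u * (1 - D * u) / (1 - q * u)"
      unfolding n(2) si c_def by (simp add: u_def)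
    have e3: "- (q ^ (n - Suc m) * D ^ Suc (Suc m) * qpoch A q (Suc (Suc m)) * qpoch B q (Suc (Suc m))
           / (qpoch q q (Suc m) * qpoch C q (Suc m)) * s (n - Suc m))
      = - c / ((1 - q * v) * (1 - C * v)) * (u * D * (1 - A * q * v) * (1 - B * q * v))"
      unfolding n(4) c_def qpoch_Suc[of A _ "Suc m"] qpoch_Suc[of B _ "Suc m"]
        qpoch_Suc[of q] qpoch_Suc[of C]
      using nz' by (simp add: u_def v_def mult_ac)
    \<comment> \<open>The induction step with its common factor removed. Through
      \<open>q ^ n = q * u * v\<close> and \<open>C = D * A * B\<close> it becomes, once
      \<open>1 - q * u\<close> is cleared, a polynomial identity.\<close>
    have id: "?P * (1 - D * u) / (1 - q * u) - ?Q - q * u * (1 - D * u) * ((1 - q * v) * (1 - C * v)) / (1 - q * u)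
        = - (u * D * (1 - A * q * v) * (1 - B * q * v))"
      using nz2(3) unfolding power_Suc qn D[symmetric] by (simp add: divide_simps) algebra
    have "(\<Sum>j\<le>Suc m. t j * (?P * s (Suc n - j) - ?Q * s (n - j)))
      = - c * q * u * (1 - D * u) / (1 - q * u)
        + c / ((1 - q * v) * (1 - C * v)) * (?P * (1 - D * u) / (1 - q * u) - ?Q)"
      unfolding sum.atMost_Suc e1 Suc.IH[OF Suc_leD[OF Suc.prems]] e2 ..
    also have "\<dots> = c / ((1 - q * v) * (1 - C * v)) * (?P * (1 - D * u) / (1 - q * u) - ?Q
        - q * u * (1 - D * u) * ((1 - q * v) * (1 - C * v)) / (1 - q * u))"
      using nz2 by (simp add: divide_simps) algebra
    also have "\<dots> = - c / ((1 - q * v) * (1 - C * v)) * (u * D * (1 - A * q * v) * (1 - B * q * v))"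
      unfolding id by simp
    finally show ?case unfolding e3 .
  qed
  have comb: "P * (\<Sum>j\<le>Suc n. t j * s (Suc n - j)) - Q * (\<Sum>j\<le>n. t j * s (n - j))
     = (\<Sum>j\<le>n. t j * (P * s (Suc n - j) - Q * s (n - j))) + P * t (Suc n) * s 0" for P Q
    by (simp add: sum_distrib_left sum_subtractf algebra_simps)
  have "?P * t (Suc n) * s 0 = D ^ Suc n * qpoch A q (Suc n) * qpoch B q (Suc n) / (qpoch q q n * qpoch C q n)"
    using P by (simp add: t_def s_def qpoch_Suc[of q] qpoch_Suc[of C])
  hence "?P * (\<Sum>j\<le>Suc n. t j * s (Suc n - j)) - ?Q * (\<Sum>j\<le>n. t j * s (n - j)) = 0"
    unfolding comb tel[OF order_refl] by (simp add: s_def)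
  hence "?P * (\<Sum>j\<le>Suc n. t j * s (Suc n - j)) =
      ?Q * (qpoch (D * B) q n * qpoch (D * A) q n / (qpoch q q n * qpoch C q n))"
    unfolding IH by simp
  moreover have "x = u / v" if "v * x = u" "v \<noteq> 0" for x u v :: complex
    using that by auto
  ultimately have "(\<Sum>j\<le>Suc n. t j * s (Suc n - j)) =
      ?Q * (qpoch (D * B) q n * qpoch (D * A) q n / (qpoch q q n * qpoch C q n)) / ?P"
    using P(1,2) by (simp only: mult_eq_0_iff simp_thms)
  also have "\<dots> = qpoch (D * B) q (Suc n) * qpoch (D * A) q (Suc n)
      / (qpoch q q (Suc n) * qpoch C q (Suc n))"
    unfolding qpoch_Suc power_Suc by (simp add: mult_ac)
  finally show ?case by (simp add: t_def s_def mult_ac)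
qed

subsection \<open>Jackson's sum\<close>

text \<open>The term of a very-well-poised series with argument \<open>q\<close>. The parameter
  \<open>k\<close> itself belongs to \<open>es\<close> and supplies the denominator
  \<open>qpoch q q n\<close>; the parameters with square roots of \<open>k\<close> are already
  merged into the first quotient.\<close>

definition vwp_term :: "complex \<Rightarrow> complex list \<Rightarrow> complex \<Rightarrow> nat \<Rightarrow> complex" where
  "vwp_term k es q n =
     (1 - k * q ^ (2 * n)) / (1 - k) * (\<Prod>e\<leftarrow>es. qpoch e q n / qpoch (k * q / e) q n) * q ^ n"

text \<open>Here \<open>s1\<close>, \<open>s2\<close>, \<open>p\<close> stand for the elementary symmetric functions of
  three of the parameters; expanding in all three separately would be far more costly.\<close>
lemma telescoping_poly:
  fixes k w s1 s2 p t :: complex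
  assumes "w \<noteq> 0" "p \<noteq> 0"
  shows "w * (1-w^2*p) *
      ((1-k*t) * (1-s1*t+s2*t^2-p*t^3) * (1-k*w*t) * (1-k*t/(w*p))
       - (1-t) * (1-k*t*s2/p+k^2*t^2*s1/p-k^3*t^3/p) * (1-t/w) * (1-w*p*t))
    = t * (1-k*t^2) *
      (w * (1-w*s2+w^2*s1*p-w^3*p^2) * (1-k/(w*p)) * (1-k*w*t) * (1-t/w)
       + (1-w*s1+w^2*s2-w^3*p) * (1-k*w) * (1-k*t/(w*p)) * (1-w*p*t))"
proof -
  \<comment> \<open>With the reciprocals as variables, the claim is a polynomial consequence of
    \<open>w*u = 1\<close> and \<open>p*v = 1\<close>.\<close>
  define u v where "u = 1/w" and "v = 1/p"
  have uv: "w*u = 1" "p*v = 1" using assms by (auto simp: u_def v_def)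
  have e: "k*t/(w*p) = k*t*u*v" "k*t*s2/p = k*t*s2*v" "k^2*t^2*s1/p = k^2*t^2*s1*v" "k^3*t^3/p = k^3*t^3*v"
    "t/w=t*u" "k/(w*p) = k*u*v" by (auto simp: u_def v_def)
  show ?thesis unfolding e using uv by algebra
qed

text \<open>One step of the telescoping for Jackson's sum, with \<open>t\<close> a power of
  \<open>q\<close> and the common factor of the terms divided out. \<open>A / E\<close> is the
  quotient of consecutive values of the telescoping sequence, so \<open>A - E\<close> represents
  their difference.\<close>

lemma telescoping_rational:
  fixes k y z b w M t :: complex
  assumes nz: "k \<noteq> 0" "y \<noteq> 0" "z \<noteq> 0" "b \<noteq> 0" "w \<noteq> 0" "w \<noteq> 1" "w * y * z * b \<noteq> 1"
    and M: "w * y * z * b * M = k"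
  defines "P \<equiv> (1 - w) * (1 - w*y*z) * (1 - w*y*b) * (1 - w*z*b)"
    and "Q \<equiv> (1 - w*y*z*b) * (1 - w*y) * (1 - w*z) * (1 - w*b)"
    and "E \<equiv> (1 - t) * (1 - k*t/y) * (1 - k*t/z) * (1 - k*t/b) * (1 - t/w) * (1 - w*y*z*b*t)"
    and "A \<equiv> (1 - k*t) * (1 - y*t) * (1 - z*t) * (1 - b*t) * (1 - k*w*t) * (1 - M*t)"
    and "c \<equiv> t * (1 - k*t\<^sup>2) * (1-y) * (1-z) * (1-b)"
  shows "P * (c * (1-M) * (1-k*w*t) * (1-t/w) / (1-1/w))
       - Q * (c * (1-k*w) * (1-M*t) * (1-w*y*z*b*t) / (1-w*y*z*b)) = (P - Q) * (A - E)"
proof -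
  define p where "p = y*z*b"
  have p: "p \<noteq> 0" "w*y*z*b = w*p" using nz by (auto simp: p_def)
  have M': "M = k/(w*p)" using M nz p(1) unfolding p(2) by (simp add: field_simps)
  have f1: "P / (1-1/w) = - w * ((1 - w*y*z) * (1 - w*y*b) * (1 - w*z*b))"
  proof -
    have "1-1/w = -(1-w)/w" using nz by (simp add: field_simps)
    thus ?thesis using nz by (simp add: P_def field_simps)
  qed
  have f0: "Q / (1-w*y*z*b) = (1 - w*y) * (1 - w*z) * (1 - w*b)"
    using nz by (simp add: Q_def)
  have g: "(1-k*t/y)*(1-k*t/z)*(1-k*t/b) = 1-k*t*(y*z+y*b+z*b)/p+k^2*t^2*(y+z+b)/p-k^3*t^3/p"
    unfolding p_def using nz by (simp add: divide_simps) algebra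
  have g': "E = (1-t)*(1-k*t*(y*z+y*b+z*b)/p+k^2*t^2*(y+z+b)/p-k^3*t^3/p)*(1-t/w)*(1-w*p*t)"
    unfolding E_def g[symmetric] p(2) by (simp add: mult_ac)
  have g2: "A = (1-k*t)*(1-(y+z+b)*t+(y*z+y*b+z*b)*t^2-p*t^3)*(1-k*w*t)*(1-k*t/(w*p))"
  proof -
    have h: "1-(y+z+b)*t+(y*z+y*b+z*b)*t^2-p*t^3 = (1 - y*t)*(1 - z*t)*(1 - b*t)"
      unfolding p_def by algebra
    show ?thesis unfolding A_def M' h by (simp add: mult_ac)
  qed
  have h1: "(1 - w*y*z) * (1 - w*y*b) * (1 - w*z*b) = 1-w*(y*z+y*b+z*b)+w^2*(y+z+b)*p-w^3*p^2"
    unfolding p_def by algebra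
  have h2: "(1 - w*y) * (1 - w*z) * (1 - w*b) = 1-w*(y+z+b)+w^2*(y*z+y*b+z*b)-w^3*p"
    unfolding p_def by algebra
  \<comment> \<open>The factors \<open>1-y\<close>, \<open>1-z\<close>, \<open>1-b\<close> found
    here also occur in \<open>c\<close>. Without them the claim is \<open>telescoping_poly\<close>
    for the elementary symmetric functions of \<open>y\<close>, \<open>z\<close>,
    \<open>b\<close>.\<close>
  have PQ: "P - Q = - w * (1-w^2*p) * ((1-y)*(1-z)*(1-b))"
    unfolding P_def Q_def p_def by algebra
  have "P * (c * (1-M) * (1-k*w*t) * (1-t/w) / (1-1/w))
       - Q * (c * (1-k*w) * (1-M*t) * (1-w*y*z*b*t) / (1-w*y*z*b))
    = c * (1-M) * (1-k*w*t) * (1-t/w) * (P / (1-1/w))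
       - c * (1-k*w) * (1-M*t) * (1-w*y*z*b*t) * (Q / (1-w*y*z*b))"
    by (simp add: mult_ac)
  also have "\<dots> = - ((1-y)*(1-z)*(1-b)) * (t*(1-k*t^2)*(w*(1-w*(y*z+y*b+z*b)+w^2*(y+z+b)*p-w^3*p^2)*(1-k/(w*p))*(1-k*w*t)*(1-t/w) + (1-w*(y+z+b)+w^2*(y*z+y*b+z*b)-w^3*p)*(1-k*w)*(1-k*t/(w*p))*(1-w*p*t)))"
    unfolding f0 f1 h1 h2 unfolding p(2) M' c_def times_divide_eq_left by algebra
  also have "\<dots> = - ((1-y)*(1-z)*(1-b)) * (w*(1-w^2*p)*(A - E))"
    unfolding telescoping_poly[OF nz(5) p(1), symmetric] g' g2 ..
  also have "\<dots> = (P - Q) * (A - E)"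
    unfolding PQ by algebra
  finally show ?thesis .
qed

text \<open>Both sums are the very-well-poised sum of Jackson, for lengths \<open>N + 1\<close> and \<open>N\<close>; in the
  notation of that sum \<open>w = a * q ^ (N + 1) / (y * z)\<close> and \<open>M = 1 / q ^ (N + 1)\<close>.
  The proof exhibits \<open>(P - Q) * G\<close> as the partial sums of \<open>P * F1 - Q * F0\<close>.\<close>
lemma vwp_recurrence:
  assumes nz: "k \<noteq> 0" "y \<noteq> 0" "z \<noteq> 0" "b \<noteq> 0" "w \<noteq> 0" "q \<noteq> 0" "k \<noteq> 1" "w \<noteq> 1" "w * y * z * b \<noteq> 1"
    and M: "w * y * z * b * M = k" "M * q ^ Suc N = 1"
    and nd: "qpoch q q (Suc N) \<noteq> 0" "qpoch (k*q/y) q (Suc N) \<noteq> 0" "qpoch (k*q/z) q (Suc N) \<noteq> 0"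
      "qpoch (k*q/b) q (Suc N) \<noteq> 0" "qpoch (w*y*z*b*q) q (Suc N) \<noteq> 0" "qpoch (q/w) q N \<noteq> 0"
  shows "(1 - w) * (1 - w*y*z) * (1 - w*y*b) * (1 - w*z*b)
           * (\<Sum>n\<le>Suc N. vwp_term k [k, y, z, b, k*w*q, M] q n)
       = (1 - w*y*z*b) * (1 - w*y) * (1 - w*z) * (1 - w*b)
           * (\<Sum>n\<le>N. vwp_term k [k, y, z, b, k*w, M*q] q n)"
proof -
  define P where "P = (1 - w) * (1 - w*y*z) * (1 - w*y*b) * (1 - w*z*b)"
  define Q where "Q = (1 - w*y*z*b) * (1 - w*y) * (1 - w*z) * (1 - w*b)"
  define F0 where "F0 = vwp_term k [k, y, z, b, k*w, M*q] q"
  define F1 where "F1 = vwp_term k [k, y, z, b, k*w*q, M] q"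
  \<comment> \<open>Chosen so that \<open>F0 (Suc m)\<close> and \<open>F1 (Suc m)\<close> are both
    explicit rational multiples of \<open>G m\<close>. The normalisation \<open>G 0 = 1\<close>
    matches \<open>F0 0 = F1 0 = 1\<close>.\<close>
  define G where "G m = qpoch (k*q) q m * qpoch (y*q) q m * qpoch (z*q) q m * qpoch (b*q) q m
      * qpoch (k*w*q) q m * qpoch (M*q) q m
    / (qpoch q q m * qpoch (k*q/y) q m * qpoch (k*q/z) q m * qpoch (k*q/b) q m
      * qpoch (q/w) q m * qpoch (w*y*z*b*q) q m)" for m
  define E' where "E' t = (1 - t) * (1 - k*t/y) * (1 - k*t/z) * (1 - k*t/b) * (1 - w*y*z*b*t)" for t
  define A where "A t = (1 - k*t) * (1 - y*t) * (1 - z*t) * (1 - b*t) * (1 - k*w*t) * (1 - M*t)" for t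
  define c where "c t = t * (1 - k*t\<^sup>2) * (1-y) * (1-z) * (1-b)" for t
  have M0: "M \<noteq> 0" using M nz by auto
  have low: "k * q / k = q" "k * q / (k * w) = q / w" "k * q / (k * w * q) = 1 / w"
    "k * q / M = w*y*z*b*q" "k * q / (M * q) = w*y*z*b"
    using nz M0 unfolding M(1)[symmetric] by auto
  have rat: "P * (c t * (1-M) * (1-k*w*t) * (1-t/w) / (1-1/w))
       - Q * (c t * (1-k*w) * (1-M*t) * (1-w*y*z*b*t) / (1-w*y*z*b)) = (P - Q) * (A t - E' t * (1-t/w))" for t
  proof -
    have "(1 - t) * (1 - k*t/y) * (1 - k*t/z) * (1 - k*t/b) * (1 - t/w) * (1 - w*y*z*b*t) = E' t * (1-t/w)"
      by (simp only: E'_def mult_ac)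
    thus ?thesis unfolding P_def Q_def c_def A_def
      using telescoping_rational[OF nz(1-5) nz(8,9) M(1), of t] by (simp only:)
  qed
  have sq: "q ^ (2 * n) = (q ^ n)\<^sup>2" for n
    by (simp add: power_mult[symmetric] mult.commute)
  have cancel: "x / (1 - k) * ((1 - k) * u / v * r) * t = x * (u / v * r) * t" for x u v r t
    using nz(7) by simp
  note fraction = times_divide_times_eq times_divide_eq_left times_divide_eq_right divide_divide_eq_left
    mult_1_left mult_1_right
  have F0_Suc: "F0 (Suc m) = G m * (c t * (1-k*w) * (1-M*t) / (E' t / (1-w*y*z*b*t) * (1-t/w) * (1-w*y*z*b)))"
    if t: "t = q ^ Suc m" and n0: "1-w*y*z*b*t \<noteq> 0" for m t
  proof -
    have e: "E' t / (1-w*y*z*b*t) = (1 - t) * (1 - k*t/y) * (1 - k*t/z) * (1 - k*t/b)"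
      using n0 by (simp add: E'_def)
    have f: "q * q ^ m = t" "x * q / x' * q ^ m = x * t / x'" "x * q * q ^ m = x * t" "q / x * q ^ m = t / x" for x x'
      using t by auto
    show ?thesis
      unfolding F0_def vwp_term_def low e G_def list.map prod_list.Cons prod_list.Nil
        qpoch_Suc_shift[of k] qpoch_Suc_shift[of y] qpoch_Suc_shift[of z] qpoch_Suc_shift[of b]
        qpoch_Suc_shift[of "k*w"] qpoch_Suc_shift[of "w*y*z*b"] low
        qpoch_Suc[of q q] qpoch_Suc[of "k*q/y"] qpoch_Suc[of "k*q/z"] qpoch_Suc[of "k*q/b"]
        qpoch_Suc[of "q/w"] qpoch_Suc[of "M*q"] c_def cancel f sq t[symmetric]
      by (simp only: fraction mult_ac)
  qed
  have F1_Suc: "F1 (Suc m) = G m * (c t * (1-M) * (1-k*w*t) / (E' t * (1-1/w)))"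
    if t: "t = q ^ Suc m" for m t
  proof -
    have f: "q * q ^ m = t" "x * q / x' * q ^ m = x * t / x'" "x * q * q ^ m = x * t" "1/w*q = q/w" for x x'
      using t by auto
    show ?thesis
      unfolding F1_def vwp_term_def low E'_def G_def list.map prod_list.Cons prod_list.Nil
        qpoch_Suc_shift[of k] qpoch_Suc_shift[of y] qpoch_Suc_shift[of z] qpoch_Suc_shift[of b]
        qpoch_Suc_shift[of "1/w"] qpoch_Suc_shift[of M] low
        qpoch_Suc[of q q] qpoch_Suc[of "k*q/y"] qpoch_Suc[of "k*q/z"] qpoch_Suc[of "k*q/b"]
        qpoch_Suc[of "k*w*q"] qpoch_Suc[of "w*y*z*b*q"] c_def cancel f sq t[symmetric]
      by (simp only: fraction mult_ac)
  qed
  have E'0: "E' (q ^ Suc m) \<noteq> 0" "1 - w*y*z*b*q ^ Suc m \<noteq> 0" if "m \<le> N" for m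
    using nd(1-5)[THEN qpoch_nonzero_factor, of m] that by (auto simp: E'_def mult_ac)
  have G_Suc: "G (Suc m) = G m * (A t / (E' t * (1-t/w)))" if "t = q ^ Suc m" for m t
    unfolding G_def A_def E'_def that qpoch_Suc by (simp add: mult_ac)
  have tel: "(\<Sum>n\<le>m. P * F1 n - Q * F0 n) = (P - Q) * G m" if "m \<le> N" for m
    using that
  proof (induction m)
    case 0
    show ?case using nz(7) by (simp add: F0_def F1_def G_def vwp_term_def)
  next
    case (Suc m)
    define t where "t = q ^ Suc m"
    have n0: "E' t \<noteq> 0" "1-w*y*z*b*t \<noteq> 0" using E'0[of m] Suc.prems by (auto simp: t_def)
    have n1: "1 - t/w \<noteq> 0" using qpoch_nonzero_factor[OF nd(6), of m] Suc.prems by (auto simp: t_def)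
    have n2: "1 - 1/w \<noteq> 0" "1-w*y*z*b \<noteq> 0" using nz by auto
    have a1: "P * F1 (Suc m) = G m / (E' t * (1-t/w)) * (P * (c t * (1-M) * (1-k*w*t) * (1-t/w) / (1-1/w)))"
      unfolding F1_Suc[OF t_def] using n0 n1 n2 nz(5) by simp
    have a2: "Q * F0 (Suc m) = G m / (E' t * (1-t/w)) * (Q * (c t * (1-k*w) * (1-M*t) * (1-w*y*z*b*t) / (1-w*y*z*b)))"
      unfolding F0_Suc[OF t_def n0(2)] using n0 n1 n2 nz(5) by simp
    have "P * F1 (Suc m) - Q * F0 (Suc m) = G m / (E' t * (1-t/w)) * ((P - Q) * (A t - E' t * (1-t/w)))"
      unfolding a1 a2 rat[symmetric] by (simp only: right_diff_distrib)
    also have "\<dots> = (P - Q) * G (Suc m) - (P - Q) * G m"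
      proof -
      have "g / d * (x * (u - d)) = x * (g * (u / d)) - x * g" if "d \<noteq> 0" for g d x u :: complex
        using that by (simp add: field_simps)
      thus ?thesis unfolding G_Suc[OF t_def] using n0(1) n1 by simp
    qed
    finally show ?case using Suc by simp
  qed
  \<comment> \<open>The last term is treated separately: \<open>qpoch (q/w) q (Suc N)\<close>, which occurs in \<open>F0 (Suc N)\<close>
    and \<open>G (Suc N)\<close>, may vanish.\<close>
  define t where "t = q ^ Suc N"
  have Mt: "M * t = 1" using M by (simp add: t_def)
  have last: "P * F1 (Suc N) = - ((P - Q) * G N)"
  proof -
    have n0: "E' t \<noteq> 0" using E'0[of N] by (auto simp: t_def)
    have n2: "1 - 1/w \<noteq> 0" using nz by auto
    \<comment> \<open>Because \<open>t = 1 / M\<close>, the quotients \<open>k*t/y\<close>,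
      \<open>k*t/z\<close>, \<open>k*t/b\<close> turn into the pairwise products in
      \<open>P\<close>. So \<open>E' t\<close> contains the factors of \<open>P\<close> other than
      \<open>1 - w\<close>, and \<open>1 - 1/w\<close> supplies that one up to a monomial.\<close>
    have kt: "k * t = w*y*z*b" using Mt M(1)[symmetric] by (simp add: mult_ac)
    have kt': "k*t/y = w*z*b" "k*t/z = w*y*b" "k*t/b = w*y*z" using nz unfolding kt by auto
    have E: "w * (E' t * (1-1/w)) = - (1-t) * (1-k*t\<^sup>2) * P"
    proof -
      have e1: "w * (1-1/w) = - (1-w)" using nz by (simp add: field_simps)
      have e2: "w*y*z*b*t = k*t\<^sup>2" unfolding kt[symmetric] by (simp add: power2_eq_square)
      have "w * (E' t * (1-1/w)) = E' t * (w * (1-1/w))" by (simp only: mult_ac)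
      also have "\<dots> = (1 - t) * (1 - w*z*b) * (1 - w*y*b) * (1 - w*y*z) * (1 - k*t\<^sup>2) * (- (1-w))"
        unfolding E'_def kt' e1 e2 ..
      also have "\<dots> = - (1-t) * (1-k*t\<^sup>2) * P"
        unfolding P_def by (simp only: mult_minus_left mult_minus_right mult_ac)
      finally show ?thesis .
    qed
    have PQ: "P - Q = - w * (1-w^2*y*z*b) * ((1-y)*(1-z)*(1-b))"
      unfolding P_def Q_def by algebra
    have kw: "k*w*t = w^2*y*z*b" using kt by algebra
    have tM: "t * (1-M) = -(1-t)" using Mt by algebra
    have "P * (c t * (1-M) * (1-k*w*t))
        = (1-w^2*y*z*b) * ((1-y)*(1-z)*(1-b)) * (t * (1-M) * (1-k*t\<^sup>2) * P)"
      unfolding c_def kw by (simp only: mult_ac)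
    also have "\<dots> = (1-w^2*y*z*b) * ((1-y)*(1-z)*(1-b)) * (w * (E' t * (1-1/w)))"
      unfolding E tM ..
    also have "\<dots> = - (P-Q) * (E' t * (1-1/w))"
      unfolding PQ by algebra
    finally have eq: "P * (c t * (1-M) * (1-k*w*t)) = - (P-Q) * (E' t * (1-1/w))" .
    have "x * (g * (u / d)) = - (v * g)" if "x * u = - v * d" "d \<noteq> 0" for x g u d v :: complex
    proof -
      have "x * (g * (u / d)) = g * (x * u) / d" by simp
      thus ?thesis using that by simp
    qed
    from this[OF eq] show ?thesis unfolding F1_Suc[OF t_def] using n0 n2 by (simp only: mult_eq_0_iff simp_thms)
  qed
  have "P * (\<Sum>n\<le>Suc N. F1 n) - Q * (\<Sum>n\<le>N. F0 n) = (\<Sum>n\<le>N. P * F1 n - Q * F0 n) + P * F1 (Suc N)"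
    by (simp add: sum_distrib_left sum_subtractf algebra_simps)
  also have "\<dots> = 0" using tel[of N] last by simp
  finally show ?thesis by (simp add: P_def Q_def F0_def F1_def)
qed

text \<open>Induction on \<open>N\<close> by \<open>vwp_recurrence\<close>. The step to length
  \<open>n\<close> asks for \<open>k \<noteq> 1\<close> and \<open>k * q ^ i \<noteq> 1\<close> with
  \<open>n \<le> i \<le> 2 * n\<close>; over all steps this is the assumption on
  \<open>qpoch k q (2 * N + 1)\<close>.\<close>

lemma jackson_generic:
  assumes nz: "q \<noteq> 0" "a \<noteq> 0" "k \<noteq> 0" "y \<noteq> 0" "z \<noteq> 0"
    and "qpoch q q N \<noteq> 0" "qpoch k q (2 * N + 1) \<noteq> 0" "qpoch (k*q/y) q N \<noteq> 0" "qpoch (k*q/z) q N \<noteq> 0"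
      "qpoch (a*q) q N \<noteq> 0" "qpoch (a*q/(y*z)) q N \<noteq> 0"
  shows "(\<Sum>n\<le>N. vwp_term k [k, y, z, k/a, k * a * q ^ (N + 1) / (y*z), 1 / q ^ N] q n)
     = qpoch (k*q) q N * qpoch (k*q/(y*z)) q N * qpoch (a*q/y) q N * qpoch (a*q/z) q N
       / (qpoch (k*q/y) q N * qpoch (k*q/z) q N * qpoch (a*q/(y*z)) q N * qpoch (a*q) q N)"
  using assms(6-)
proof (induction N)
  case 0
  thus ?case by (auto simp: vwp_term_def qpoch_Suc)
next
  case (Suc N)
  \<comment> \<open>With these values \<open>k*w\<close> and \<open>M*q\<close> are the
    length-dependent parameters at \<open>N\<close>, while \<open>k*w*q\<close> and \<open>M\<close>
    are those at \<open>Suc N\<close>.\<close>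
  define b where "b = k / a"
  define w where "w = a * q ^ Suc N / (y * z)"
  define M where "M = 1 / q ^ Suc N"
  note nd = Suc.prems
  have k1: "k \<noteq> 1" using qpoch_nonzero_factor[OF nd(2), of 0] by simp
  have w: "w * y * z * b = k * q ^ Suc N" "w * y * z = a * q ^ Suc N" "w * y * b = k * q ^ Suc N / z"
    "w * z * b = k * q ^ Suc N / y" "w * y = a * q ^ Suc N / z" "w * z = a * q ^ Suc N / y"
    "w * b = k * q ^ Suc N / (y * z)" "k * q / b = a * q"
    using nz by (simp_all add: w_def b_def)
  have w0: "b \<noteq> 0" "w \<noteq> 0" "w * y * z * b * M = k" "M * q ^ Suc N = 1"
    using nz unfolding w by (simp_all add: w_def b_def M_def)
  have w1: "w \<noteq> 1" using qpoch_nonzero_factor[OF nd(6), of N] by (simp add: w_def mult_ac)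
  have k2: "k * q ^ Suc N \<noteq> 1" using qpoch_nonzero_factor[OF nd(2), of "Suc N"] by simp
  have k3: "qpoch (k * q ^ Suc N * q) q (Suc N) \<noteq> 0"
    using qpoch_nonzero_shift[OF nd(2), of "Suc (Suc N)" "Suc N"] by (simp add: mult_ac)
  have nd': "qpoch q q N \<noteq> 0" "qpoch k q (2 * N + 1) \<noteq> 0" "qpoch (k*q/y) q N \<noteq> 0" "qpoch (k*q/z) q N \<noteq> 0"
      "qpoch (a*q) q N \<noteq> 0" "qpoch (a*q/(y*z)) q N \<noteq> 0"
    using nd[THEN qpoch_nonzero_mono] by auto
  have x0: "a*q/(y*z) \<noteq> 0" using nz by simp
  \<comment> \<open>Reversing \<open>qpoch (a*q/(y*z)) q N\<close> shows that
    \<open>qpoch (q/w) q N\<close> cannot vanish.\<close>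
  have "q / w = q / (a*q/(y*z) * q ^ N)" by (simp add: w_def mult_ac)
  hence qw: "qpoch (q / w) q N \<noteq> 0"
    using qpoch_reverse[OF x0 nz(1), of N N] nd'(6) by auto
  have e0: "k * a * q ^ (N + 1) / (y*z) = k * w" "k * a * q ^ (Suc N + 1) / (y*z) = k * w * q"
    "1 / q ^ N = M * q" "1 / q ^ Suc N = M"
    using nz by (simp_all add: w_def M_def)
  note rec = vwp_recurrence[where N = N, OF nz(3,4,5) w0(1,2) nz(1) k1 w1 _ w0(3,4) nd(1,3,4) _ _ qw, unfolded w(8),
      OF _ nd(5), unfolded w(1), OF k2 k3, unfolded w(2-4), unfolded w(5-7)]
  have "(1 - w) * (1 - a * q ^ Suc N) * (1 - k * q ^ Suc N / z) * (1 - k * q ^ Suc N / y)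
     * (\<Sum>n\<le>Suc N. vwp_term k [k, y, z, b, k*w*q, M] q n)
    = (1 - k * q ^ Suc N) * (1 - a * q ^ Suc N / z) * (1 - a * q ^ Suc N / y) * (1 - k * q ^ Suc N / (y * z))
     * (qpoch (k*q) q N * qpoch (k*q/(y*z)) q N * qpoch (a*q/y) q N * qpoch (a*q/z) q N
       / (qpoch (k*q/y) q N * qpoch (k*q/z) q N * qpoch (a*q/(y*z)) q N * qpoch (a*q) q N))"
    (is "?P * ?S = ?R")
    using rec Suc.IH[OF nd', folded b_def, unfolded e0] by (simp only:)
  moreover have "x = u / v" if "v * x = u" "v \<noteq> 0" for x u v :: complex
    using that by auto
  ultimately have S: "?P \<noteq> 0 \<Longrightarrow> ?S = ?R / ?P" by blast
  have f: "x * q / v * q ^ N = x * q ^ Suc N / v" "x * q * q ^ N = x * q ^ Suc N" for x v by simp_all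
  have P: "1 - w \<noteq> 0" "1 - a * q ^ Suc N \<noteq> 0" "1 - k * q ^ Suc N / z \<noteq> 0" "1 - k * q ^ Suc N / y \<noteq> 0"
    using w1 nd(3-5)[THEN qpoch_nonzero_factor, of N] unfolding f by auto
  show ?case
    unfolding e0 b_def[symmetric] qpoch_Suc f
    using P by (subst S) (simp_all add: w_def mult_ac)
qed

section \<open>Removing the genericity of \<open>k\<close> by continuity\<close>

lemma tendsto_qpoch [tendsto_intros]:
  "(f \<longlongrightarrow> l) F \<Longrightarrow> ((\<lambda>x. qpoch (f x) q n) \<longlongrightarrow> qpoch l q n) F"
  unfolding qpoch_def by (intro tendsto_intros)

text \<open>Each of the finitely many factors vanishes at a single point, which a punctured
  neighbourhood avoids.\<close>

lemma eventually_qpoch_nonzero: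
  assumes "q \<noteq> 0"
  shows "\<forall>\<^sub>F x in at c. qpoch x q n \<noteq> 0"
proof (induction n)
  case (Suc n)
  have "\<forall>\<^sub>F x in at c. x \<noteq> 1 / q ^ n"
    by (rule eventually_neq_at_within)
  with Suc show ?case
    by eventually_elim (use assms in \<open>auto simp: qpoch_Suc field_simps\<close>)
qed simp

text \<open>The recurrence in \<open>N\<close> needs \<open>k * q ^ i \<noteq> 1\<close> also for \<open>1 \<le> i \<le> N\<close>, although no denominator
  of the identity vanishes there; these \<open>k\<close> are reached by continuity.\<close>
lemma jackson:
  assumes nz: "q \<noteq> 0" "a \<noteq> 0" "k \<noteq> 0" "y \<noteq> 0" "z \<noteq> 0"
    and nd: "k \<noteq> 1" "qpoch q q N \<noteq> 0" "qpoch (k * q ^ (N + 1)) q N \<noteq> 0" "qpoch (k*q/y) q N \<noteq> 0" "qpoch (k*q/z) q N \<noteq> 0"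
      "qpoch (a*q) q N \<noteq> 0" "qpoch (a*q/(y*z)) q N \<noteq> 0"
  shows "(\<Sum>n\<le>N. vwp_term k [k, y, z, k/a, k * a * q ^ (N + 1) / (y*z), 1 / q ^ N] q n)
     = qpoch (k*q) q N * qpoch (k*q/(y*z)) q N * qpoch (a*q/y) q N * qpoch (a*q/z) q N
       / (qpoch (k*q/y) q N * qpoch (k*q/z) q N * qpoch (a*q/(y*z)) q N * qpoch (a*q) q N)"
proof -
  \<comment> \<open>The lower parameters \<open>k*q/e\<close> are simplified so that every term is
    visibly continuous in \<open>k\<close>; this form agrees with \<open>vwp_term\<close> for
    \<open>k \<noteq> 0\<close>.\<close>
  define L where "L k = (\<Sum>n\<le>N. (1 - k * q ^ (2 * n)) / (1 - k) * (qpoch k q n / qpoch q q n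
      * (qpoch y q n / qpoch (k*q/y) q n) * (qpoch z q n / qpoch (k*q/z) q n)
      * (qpoch (k/a) q n / qpoch (a*q) q n)
      * (qpoch (k * a * q ^ (N + 1) / (y*z)) q n / qpoch (q / (a*q/(y*z) * q ^ N)) q n)
      * (qpoch (1 / q ^ N) q n / qpoch (k * q ^ (N + 1)) q n)) * q ^ n)" for k
  define R where "R k = qpoch (k*q) q N * qpoch (k*q/(y*z)) q N * qpoch (a*q/y) q N * qpoch (a*q/z) q N
       / (qpoch (k*q/y) q N * qpoch (k*q/z) q N * qpoch (a*q/(y*z)) q N * qpoch (a*q) q N)" for k
  have L: "(\<Sum>n\<le>N. vwp_term k [k, y, z, k/a, k * a * q ^ (N + 1) / (y*z), 1 / q ^ N] q n) = L k"
    if "k \<noteq> 0" for k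
  proof -
    have "k * q / k = q" "k * q / (k / a) = a * q" "k * q / (1 / q ^ N) = k * q ^ (N + 1)"
      "k * q / (k * a * q ^ (N + 1) / (y*z)) = q / (a*q/(y*z) * q ^ N)"
      using that nz by auto
    thus ?thesis
      unfolding L_def vwp_term_def by (simp only: list.map prod_list.Cons prod_list.Nil mult_1_right mult.assoc)
  qed
  have x0: "a*q/(y*z) \<noteq> 0" using nz by simp
  have qw: "qpoch (q / (a*q/(y*z) * q ^ N)) q N \<noteq> 0"
    using qpoch_reverse[OF x0 nz(1), of N N] nd(7) by auto
  have "(L \<longlongrightarrow> L k) (at k)"
    unfolding L_def using nd qw nz
    by (intro tendsto_intros) (auto dest: qpoch_nonzero_mono)
  moreover have "(R \<longlongrightarrow> R k) (at k)"
    unfolding R_def using nd nz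
    by (intro tendsto_intros) auto
  moreover have "\<forall>\<^sub>F c in at k. L c = R c"
  proof -
    have "\<forall>\<^sub>F c in at k. c \<noteq> 0" "\<forall>\<^sub>F c in at k. qpoch c q (2 * N + 1) \<noteq> 0"
      using nz by (auto intro: eventually_neq_at_within eventually_qpoch_nonzero)
    moreover have "\<forall>\<^sub>F c in at k. qpoch (c*q/y) q N \<noteq> 0"
      using nz by (intro tendsto_imp_eventually_ne[OF _ nd(4)] tendsto_intros)
    moreover have "\<forall>\<^sub>F c in at k. qpoch (c*q/z) q N \<noteq> 0"
      using nz by (intro tendsto_imp_eventually_ne[OF _ nd(5)] tendsto_intros)
    ultimately show ?thesis
    proof eventually_elim
      case (elim c)
      show ?case unfolding L[OF elim(1), symmetric] R_def
        by (rule jackson_generic) (use nz nd elim in auto)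
    qed
  qed
  ultimately have "L k = R k"
    by (metis tendsto_cong tendsto_unique at_neq_bot)
  thus ?thesis by (simp only: L[OF nz(3)] R_def)
qed

section \<open>Jackson's sum with shifted parameters\<close>

text \<open>The final cancellation for \<open>jackson_shifted\<close>, with letters in place of
  factorials: \<open>KN\<close>, \<open>AN\<close> are those of \<open>k*q\<close>,
  \<open>a*q\<close> at length \<open>N\<close>, \<open>R1\<close>, \<open>R2\<close> reversed
  blocks, and \<open>m1\<close>, \<open>m2\<close>, \<open>p\<close> the monomials of the
  reversals.\<close>

lemma jackson_shift_cancel:
  fixes K3 :: complex
  assumes "K3 \<noteq> 0" "R1 \<noteq> 0" "p \<noteq> 0" "y0 \<noteq> 0" "z0 \<noteq> 0" "m2 \<noteq> 0"
  and "e * k2 * K' = KN * K3" "A2 * A' = AN * AN1" "m1 * u = m2 * qr"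
  shows "e * (s / (ky * kz * R2 * K3) * qr * (k2 / A2)) * (K' * V1 * Y * Z / (Ky * Kz * V2 * A'))
   = KN * (V1 * R1 * (m1 * p)) * (y0 * Y) * (z0 * Z) / ((ky * Ky) * (kz * Kz) * (V2 * R2 * (m2 * p)) * AN)
     * (s / (y0 * z0 * R1 * AN1) * u)" (is "?l = ?r")
proof -
  have "?r = KN * (m1 * u) * V1 * Y * Z * s / (ky * Ky * kz * Kz * V2 * R2 * m2 * (AN * AN1))"
    using assms(1-6) by (simp add: mult_ac)
  also have "\<dots> = (KN * K3) * qr * V1 * Y * Z * s / (ky * Ky * kz * Kz * V2 * R2 * (A2 * A') * K3)"
    unfolding assms(8,9) using assms(1-6) by (simp add: mult_ac)
  also have "\<dots> = ?l"
    unfolding assms(7)[symmetric] by (simp add: mult_ac)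
  finally show ?thesis ..
qed


text \<open>Jackson's sum of length \<open>N - r\<close> for \<open>k q^(2r)\<close>,
  \<open>a q^(2r)\<close>, \<open>y q^r\<close>, \<open>z q^r\<close>; the ratios
  \<open>k/a\<close>, \<open>k*q/(y*z)\<close> and \<open>a*q/(y*z)\<close> do not change. The new
  base must differ from 1, whence the condition on \<open>k * q ^ (2 * i)\<close>.\<close>

lemma jackson_shifted:
  fixes k a y z q :: complex and N :: nat
  assumes nz: "q \<noteq> 0" "a \<noteq> 0" "k \<noteq> 0" "y \<noteq> 0" "z \<noteq> 0"
    and nd: "\<And>i. i \<le> N \<Longrightarrow> k * q ^ (2 * i) \<noteq> 1" "qpoch q q N \<noteq> 0" "qpoch (k * q ^ (N + 1)) q N \<noteq> 0" "qpoch (k*q/y) q N \<noteq> 0" "qpoch (k*q/z) q N \<noteq> 0"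
      "qpoch (a*q) q (2 * N) \<noteq> 0" "qpoch (a*q/(y*z)) q N \<noteq> 0"
      "qpoch (a*q/y) q N \<noteq> 0" "qpoch (a*q/z) q N \<noteq> 0" "qpoch (q / (k*q/(y*z) * q ^ N)) q N \<noteq> 0"
    and r: "r \<le> N"
  defines "x \<equiv> k * a * q ^ (N + 1) / (y*z)"
  defines "W \<equiv> \<lambda>n. (1 - k * q ^ (2*n)) / (1 - k) * (qpoch y q n * qpoch z q n * qpoch x q n * qpoch (1 / q ^ N) q n)
      / (qpoch (k*q/y) q n * qpoch (k*q/z) q n * qpoch (q / (a*q/(y*z) * q ^ N)) q n * qpoch (k * q ^ (N + 1)) q n)
      * q ^ n"
  shows "(\<Sum>m\<le>N - r. W (r + m) * (qpoch (k/a) q m * qpoch k q (2 * r + m) / (qpoch q q m * qpoch (a*q) q (2 * r + m))))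
    = qpoch (k*q) q N * qpoch (k*q/(y*z)) q N * qpoch (a*q/y) q N * qpoch (a*q/z) q N
       / (qpoch (k*q/y) q N * qpoch (k*q/z) q N * qpoch (a*q/(y*z)) q N * qpoch (a*q) q N)
     * (qpoch y q r * qpoch z q r * qpoch x q r * qpoch (1 / q ^ N) q r
        / (qpoch (a*q/y) q r * qpoch (a*q/z) q r * qpoch (q / (k*q/(y*z) * q ^ N)) q r * qpoch (a * q ^ (N + 1)) q r)
        * (a*q/k) ^ r)"
proof -
  define k' where "k' = k * q ^ (2*r)"
  define a' where "a' = a * q ^ (2*r)"
  define y' where "y' = y * q ^ r"
  define z' where "z' = z * q ^ r"
  define M where "M = N - r"
  have N: "N = r + M" using r by (simp add: M_def)
  have nz': "a' \<noteq> 0" "k' \<noteq> 0" "y' \<noteq> 0" "z' \<noteq> 0" using nz by (auto simp: k'_def a'_def y'_def z'_def)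
  have p2: "q ^ (2*r) = q ^ r * q ^ r" by (simp add: mult_2 power_add)
  have par: "k' / a' = k / a" "k' * a' * q ^ (M + 1) / (y'*z') = x * q ^ r" "1 / q ^ M = 1 / q ^ N * q ^ r"
    "k'*q/y' = k*q/y * q ^ r" "k'*q/z' = k*q/z * q ^ r" "a'*q/y' = a*q/y * q ^ r" "a'*q/z' = a*q/z * q ^ r"
    "k'*q/(y'*z') = k*q/(y*z)" "a'*q/(y'*z') = a*q/(y*z)"
    "k' * q / k' = q" "k' * q / (k / a) = a * q * q ^ (2*r)"
    "k' * q / (x * q ^ r) = q / (a*q/(y*z) * q ^ N) * q ^ r"
    "k' * q / (1 / q ^ N * q ^ r) = k * q ^ (N + 1) * q ^ r"
    "k' * q ^ (M + 1) = k * q ^ (N + 1) * q ^ r"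
    using nz by (simp_all add: k'_def a'_def y'_def z'_def x_def N p2 power_add)
  have par': "a' * q = a * q * q ^ (2*r)" "k' * q = k * q * q ^ (2*r)"
    by (simp_all add: k'_def a'_def mult_ac)
  have k1: "k \<noteq> 1" "k' \<noteq> 1" using nd(1)[of 0] nd(1)[OF r] by (simp_all add: k'_def)
  have x0: "k*q/(y*z) \<noteq> 0" "a*q/(y*z) \<noteq> 0" using nz by auto
  have nd': "qpoch q q M \<noteq> 0" "qpoch (k' * q ^ (M + 1)) q M \<noteq> 0" "qpoch (k'*q/y') q M \<noteq> 0"
    "qpoch (k'*q/z') q M \<noteq> 0" "qpoch (a'*q) q M \<noteq> 0" "qpoch (a'*q/(y'*z')) q M \<noteq> 0"
    unfolding par unfolding par'
    using qpoch_nonzero_mono[OF nd(2), of M] qpoch_nonzero_mono[OF nd(7), of M]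
      nd(3-5)[THEN qpoch_nonzero_shift, of r M] qpoch_nonzero_shift[OF nd(6), of "2 * r" M]
    by (simp_all add: N)
  note J = jackson[OF nz(1) nz' k1(2) nd', unfolded par, unfolded par']
  define c where "c = 1 / (1 - k) * (qpoch y q r * qpoch z q r * qpoch x q r * qpoch (1 / q ^ N) q r)
      / (qpoch (k*q/y) q r * qpoch (k*q/z) q r * qpoch (q / (a*q/(y*z) * q ^ N)) q r * qpoch (k * q ^ (N + 1)) q r)
      * q ^ r * (qpoch k q (2*r) / qpoch (a*q) q (2*r))"
  have kadd: "1 - k * q ^ (2 * (r + m)) = 1 - k' * q ^ (2*m)" for m
    by (simp add: k'_def power_add)
  have summand: "W (r + m) * (qpoch (k/a) q m * qpoch k q (2 * r + m) / (qpoch q q m * qpoch (a*q) q (2 * r + m)))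
      = (1 - k') * c * vwp_term k' [k', y', z', k/a, x * q ^ r, 1 / q ^ N * q ^ r] q m" for m
  proof -
    have cancel: "(1 - k') * c * (u / (1 - k') * v * w) = c * (u * v * w)" for u v w using k1 by simp
    show ?thesis
      unfolding W_def vwp_term_def kadd list.map prod_list.Cons prod_list.Nil par cancel
        qpoch_add power_add[of q r m] y'_def[symmetric] z'_def[symmetric] k'_def[symmetric]
      unfolding c_def
      by (simp only: times_divide_times_eq times_divide_eq_left times_divide_eq_right divide_divide_eq_left
          mult_1_left mult_1_right mult_ac)
  qed
  \<comment> \<open>The quotient in front turns \<open>qpoch k q (2*r)\<close> into
    \<open>qpoch (k*q) q (2*r)\<close>. Since \<open>2*r + M = N + r\<close>, the resulting product
    can be cut at \<open>N\<close> instead of \<open>2*r\<close>.\<close>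
  have E1: "(1 - k') / (1 - k) * qpoch k q (2*r) * qpoch (k*q*q^(2*r)) q M = qpoch (k*q) q N * qpoch (k * q ^ (N + 1)) q r"
  proof -
    have "qpoch k q (2*r) * (1 - k') = (1 - k) * qpoch (k*q) q (2*r)"
      using qpoch_Suc[of k q "2*r"] qpoch_Suc_shift[of k q "2*r"] by (simp add: k'_def)
    hence "(1 - k') / (1 - k) * qpoch k q (2*r) = qpoch (k*q) q (2*r)"
      using k1 by (simp add: mult_ac)
    moreover have "qpoch (k*q) q (2*r) * qpoch (k*q*q^(2*r)) q M = qpoch (k*q) q N * qpoch (k*q*q^N) q r"
      unfolding qpoch_add[symmetric] by (simp add: N mult_2 add_ac)
    ultimately show ?thesis by (simp add: mult_ac)
  qed
  have E2: "qpoch (a*q) q (2*r) * qpoch (a*q*q^(2*r)) q M = qpoch (a*q) q N * qpoch (a * q ^ (N + 1)) q r"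
  proof -
    have "qpoch (a*q) q (2*r) * qpoch (a*q*q^(2*r)) q M = qpoch (a*q) q N * qpoch (a*q*q^N) q r"
      unfolding qpoch_add[symmetric] by (simp add: N mult_2 add_ac)
    thus ?thesis by (simp add: mult_ac)
  qed
  have E3: "qpoch v q N = qpoch v q r * qpoch (v * q ^ r) q M" for v
    by (simp add: N qpoch_add)
  define R where "R v = qpoch (q / (v * q ^ N)) q r" for v
  define p where "p = (\<Prod>i<r. q ^ (N - Suc i))"
  \<comment> \<open>Used for \<open>v = k*q/(y*z)\<close> and \<open>v = a*q/(y*z)\<close>. The
    power \<open>p\<close> is the same for both and cancels; the remaining monomials, together with
    \<open>q ^ r\<close>, give \<open>(a*q/k) ^ r\<close>.\<close>
  have E4: "v \<noteq> 0 \<Longrightarrow> qpoch v q N = qpoch v q M * R v * ((- v) ^ r * p)" for v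
    using qpoch_reverse[OF _ nz(1) r, of v] by (simp add: R_def p_def M_def)
  have p0: "p \<noteq> 0" using nz by (simp add: p_def)
  have m: "(- (k*q/(y*z))) ^ r * (a*q/k) ^ r = (- (a*q/(y*z))) ^ r * q ^ r"
    unfolding power_mult_distrib[symmetric] using nz by (simp add: field_simps)
  have low: "qpoch (k * q ^ (N + 1)) q r \<noteq> 0" "R (k*q/(y*z)) \<noteq> 0" "qpoch (a*q/y) q r \<noteq> 0"
    "qpoch (a*q/z) q r \<noteq> 0" "(- (a*q/(y*z))) ^ r \<noteq> 0"
    using nd(3,8,9,10)[THEN qpoch_nonzero_mono, OF r] nz by (simp_all add: R_def)
  have "(\<Sum>m\<le>N - r. W (r + m) * (qpoch (k/a) q m * qpoch k q (2 * r + m) / (qpoch q q m * qpoch (a*q) q (2 * r + m))))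
    = (1 - k') * c * (\<Sum>m\<le>M. vwp_term k' [k', y', z', k/a, x * q ^ r, 1 / q ^ N * q ^ r] q m)"
    unfolding summand M_def sum_distrib_left ..
  also have "(1 - k') * c = (1 - k') / (1 - k) * ((qpoch y q r * qpoch z q r * qpoch x q r * qpoch (1 / q ^ N) q r)
      / (qpoch (k*q/y) q r * qpoch (k*q/z) q r * R (a*q/(y*z)) * qpoch (k * q ^ (N + 1)) q r)
      * q ^ r * (qpoch k q (2*r) / qpoch (a*q) q (2*r)))"
    by (simp add: c_def R_def)
  finally show ?thesis
    unfolding J R_def[of "k*q/(y*z)", symmetric] E3[of "k*q/y"] E3[of "k*q/z"] E3[of "a*q/y"] E3[of "a*q/z"]
      E4[OF x0(1)] E4[OF x0(2)]
    by (simp only: jackson_shift_cancel[OF low(1,2) p0 low(3-5) E1 E2 m])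
qed

subsection \<open>The transformation\<close>

lemma sum_triangle_shift:
  fixes f :: "nat \<Rightarrow> nat \<Rightarrow> 'a :: comm_monoid_add"
  shows "(\<Sum>n\<le>N. \<Sum>r\<le>n. f n r) = (\<Sum>r\<le>N. \<Sum>m\<le>N - r. f (r + m) r)"
  by (induction N) (simp_all add: Suc_diff_le sum.distrib add_ac)

text \<open>Cutting the factorials of length \<open>n + r\<close> at \<open>n\<close> leaves the
  q-Saalschuetz sum, whose balance condition is \<open>D * A * B = C\<close>. Its factor
  \<open>qpoch (k\<^sup>2/a * q ^ n) q n\<close> is the second half of one of length
  \<open>2*n\<close>.\<close>

lemma wp_bailey_beta:
  assumes nz: "q \<noteq> 0" "a \<noteq> 0" "k \<noteq> 0" and nd: "qpoch q q n \<noteq> 0" "qpoch (a*q) q (2*n) \<noteq> 0"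
    "qpoch (k\<^sup>2/a) q n \<noteq> 0"
  shows "(\<Sum>r\<le>n. qpoch (k/a) q (n - r) * qpoch k q (n + r) / (qpoch q q (n - r) * qpoch (a*q) q (n + r))
            * (qpoch (q*a\<^sup>2/k\<^sup>2) q r / qpoch q q r * (k/a) ^ r))
       = qpoch k q n * qpoch (q*a/k) q n * qpoch (k\<^sup>2/a) q (2*n)
          / (qpoch q q n * qpoch (k\<^sup>2/a) q n * qpoch (a*q) q (2*n))"
proof -
  define A B C D where "A = k * q ^ n" and "B = q*a\<^sup>2/k\<^sup>2" and "C = a*q*q^n" and "D = k/a"
  have rel: "D * A * B = C" "D * B = q*a/k" "D * A = k\<^sup>2/a * q ^ n"
    using nz by (simp_all add: A_def B_def C_def D_def power2_eq_square)
  have ABC: "A \<noteq> 0" "B \<noteq> 0" "qpoch C q n \<noteq> 0"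
    using nz qpoch_nonzero_shift[OF nd(2), of n n] by (simp_all add: A_def B_def C_def)
  have "(\<Sum>r\<le>n. qpoch D q (n - r) * qpoch k q (n + r) / (qpoch q q (n - r) * qpoch (a*q) q (n + r))
            * (qpoch B q r / qpoch q q r * D ^ r))
      = qpoch k q n / qpoch (a*q) q n
       * (\<Sum>r\<le>n. qpoch A q r * qpoch B q r / (qpoch q q r * qpoch C q r) * (qpoch D q (n - r) / qpoch q q (n - r)) * D ^ r)"
    unfolding qpoch_add A_def[symmetric] C_def[symmetric] sum_distrib_left
    by (simp add: mult_ac)
  also have "\<dots> = qpoch k q n / qpoch (a*q) q n
       * (qpoch (q*a/k) q n * qpoch (k\<^sup>2/a * q ^ n) q n / (qpoch q q n * qpoch C q n))"
    unfolding q_saalschuetz[OF ABC(1,2) nd(1) ABC(3) rel(1)] unfolding rel ..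
  also have "\<dots> = qpoch k q n * qpoch (q*a/k) q n * qpoch (k\<^sup>2/a) q (2*n)
          / (qpoch q q n * qpoch (k\<^sup>2/a) q n * qpoch (a*q) q (2*n))"
    unfolding mult_2 qpoch_add C_def using nd(3) by simp
  finally show ?thesis unfolding D_def B_def .
qed

theorem corollary10:
  fixes q a k y z sk sa saq sqa :: complex and N :: nat
  assumes "N \<ge> 1"
    and "q \<noteq> 0" and "a \<noteq> 0" and "k \<noteq> 0" and "y \<noteq> 0" and "z \<noteq> 0"
    and "sk ^ 2 = k" and "sa ^ 2 = a" and "saq ^ 2 = a * q" and "sqa ^ 2 = q / a"
    and "\<forall>n\<le>N. qpochs (q # [sk, - sk, q * k / y, q * k / z, k ^ 2 / a, saq, - saq, q * sa, - q * sa,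
            k * q ^ (N + 1), y * z * q powi (- int N) / a]) q n \<noteq> 0"
    and "\<forall>n\<le>N. qpochs (q # [q * a / y, q * a / z, a * q ^ (N + 1),
            y * z * q powi (- int N) / k]) q n \<noteq> 0"
    and "qpochs [k * q / y, k * q / z, a * q / (y * z), a * q] q N \<noteq> 0"
  shows "qhyp [k, q * sk, - q * sk, y, z, q * a / k, k / sa, - k / sa, k * sqa, - k * sqa,
            k * a * q ^ (N + 1) / (y * z), q powi (- int N)]
           [sk, - sk, q * k / y, q * k / z, k ^ 2 / a, saq, - saq, q * sa, - q * sa,
            k * q ^ (N + 1), y * z * q powi (- int N) / a] q q
       = qpochs [k * q, k * q / (y * z), a * q / y, a * q / z] q N
           / qpochs [k * q / y, k * q / z, a * q / (y * z), a * q] q N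
         * qhyp [y, z, q * a ^ 2 / k ^ 2, k * a * q ^ (N + 1) / (y * z), q powi (- int N)]
             [q * a / y, q * a / z, a * q ^ (N + 1), y * z * q powi (- int N) / k] q q"
proof -
  note nz = assms(2-6)
  define x where "x = k * a * q ^ (N + 1) / (y*z)"
  define M where "M = 1 / q ^ N"
  define la where "la = y * z * q powi (- int N) / a"
  define lk where "lk = y * z * q powi (- int N) / k"
  have qN: "q powi (- int N) = M" by (simp add: M_def power_int_minus field_simps)
  have la: "q / (a*q/(y*z) * q ^ N) = la" and lk: "q / (k*q/(y*z) * q ^ N) = lk"
    using nz by (simp_all add: la_def lk_def power_int_minus field_simps)
  have com: "q * k / y = k*q/y" "q * k / z = k*q/z" "q * a / y = a*q/y" "q * a / z = a*q/z" by simp_all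
  define W where "W n = (1 - k * q ^ (2*n)) / (1 - k) * (qpoch y q n * qpoch z q n * qpoch x q n * qpoch M q n)
      / (qpoch (k*q/y) q n * qpoch (k*q/z) q n * qpoch la q n * qpoch (k * q ^ (N + 1)) q n) * q ^ n" for n
  define Z where "Z r = qpoch y q r * qpoch z q r * qpoch x q r * qpoch M q r
        / (qpoch (a*q/y) q r * qpoch (a*q/z) q r * qpoch lk q r * qpoch (a * q ^ (N + 1)) q r)
        * (a*q/k) ^ r" for r
  define \<alpha> where "\<alpha> r = qpoch (q*a\<^sup>2/k\<^sup>2) q r / qpoch q q r * (k/a) ^ r" for r
  define \<gamma> where "\<gamma> n r = qpoch (k/a) q (n - r) * qpoch k q (n + r) / (qpoch q q (n - r) * qpoch (a*q) q (n + r))" for n r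
  define \<beta> where "\<beta> n = qpoch k q n * qpoch (q*a/k) q n * qpoch (k\<^sup>2/a) q (2*n)
          / (qpoch q q n * qpoch (k\<^sup>2/a) q n * qpoch (a*q) q (2*n))" for n
  define K where "K = qpoch (k*q) q N * qpoch (k*q/(y*z)) q N * qpoch (a*q/y) q N * qpoch (a*q/z) q N
       / (qpoch (k*q/y) q N * qpoch (k*q/z) q N * qpoch (a*q/(y*z)) q N * qpoch (a*q) q N)"
  have sqs: "(q * sa)\<^sup>2 = a * q * q" "(q * sk)\<^sup>2 = k * q\<^sup>2" "(k / sa)\<^sup>2 = k\<^sup>2 / a" "(k * sqa)\<^sup>2 = k\<^sup>2 / a * q"
    by (simp_all add: power_mult_distrib power_divide assms(7,8,10)) (simp add: power2_eq_square)
  have neg: "- q * sa = - (q * sa)" "- q * sk = - (q * sk)" "- k / sa = - (k / sa)" "- k * sqa = - (k * sqa)"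
    by simp_all
  have nd: "qpoch q q N \<noteq> 0" "qpoch sk q N * qpoch (- sk) q N \<noteq> 0" "qpoch (k*q/y) q N \<noteq> 0" "qpoch (k*q/z) q N \<noteq> 0"
      "qpoch (k\<^sup>2/a) q N \<noteq> 0" "qpoch saq q N * qpoch (- saq) q N \<noteq> 0" "qpoch (q * sa) q N * qpoch (- (q * sa)) q N \<noteq> 0"
      "qpoch (k * q ^ (N + 1)) q N \<noteq> 0"
    using assms(11)[rule_format, of N] unfolding com neg by (simp_all add: qpochs_def)
  have nd2: "qpoch (a*q/y) q N \<noteq> 0" "qpoch (a*q/z) q N \<noteq> 0" "qpoch lk q N \<noteq> 0"
    using assms(12)[rule_format, of N] unfolding lk_def[symmetric] com by (simp_all add: qpochs_def)
  have nd3: "qpoch (a*q/(y*z)) q N \<noteq> 0"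
    using assms(13) by (simp add: qpochs_def)
  \<comment> \<open>The four lower parameters \<open>saq\<close>, \<open>- saq\<close>,
    \<open>q * sa\<close>, \<open>- q * sa\<close> merge into this single factorial.\<close>
  have aq: "qpoch (a*q) q (2*N) \<noteq> 0"
    using nd(6,7) unfolding qpoch_sqrt_pair qpoch_double sqs assms(9) by simp
  \<comment> \<open>For \<open>i < N\<close> this comes from the lower parameters \<open>sk\<close>
    and \<open>- sk\<close>, which give \<open>k\<close> in base \<open>q^2\<close>. For
    \<open>i = N\<close> it is the last factor of \<open>qpoch (k * q ^ (N + 1)) q N\<close>, which
    exists because \<open>N \<ge> 1\<close>.\<close>
  have k2: "k * q ^ (2 * i) \<noteq> 1" if "i \<le> N" for i
  proof (cases "i = N")
    case True
    have "N + 1 + (N - 1) = 2 * N" using assms(1) by simp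
    with qpoch_nonzero_factor[OF nd(8), of "N - 1"] assms(1) True show ?thesis
      by (simp add: mult.assoc power_add[symmetric] mult_2 del: power_Suc)
  next
    case False
    hence "k * (q\<^sup>2) ^ i \<noteq> 1"
      using nd(2) that unfolding qpoch_sqrt_pair assms(7) by (intro qpoch_nonzero_factor) auto
    thus ?thesis by (simp add: power_mult)
  qed
  have k1: "k \<noteq> 1" using k2[of 0] by simp
  have lhs: "qpochs [k, q * sk, - q * sk, y, z, q * a / k, k / sa, - k / sa, k * sqa, - k * sqa, x, M] q n
      / qpochs (q # [sk, - sk, q * k / y, q * k / z, k ^ 2 / a, saq, - saq, q * sa, - q * sa,
            k * q ^ (N + 1), la]) q n * q ^ n = W n * \<beta> n" if n: "n \<le> N" for n
  proof -
    have sk0: "qpoch k (q\<^sup>2) n \<noteq> 0"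
      using nd(2) n qpoch_nonzero_mono unfolding qpoch_sqrt_pair assms(7) by blast
    \<comment> \<open>Adding the next factor to \<open>(k;q^2)_n\<close> and dropping its first one
      gives \<open>(k q^2;q^2)_n\<close>; the quotient left over is the very-well-poised factor in
      \<open>W\<close>.\<close>
    have "qpoch k (q\<^sup>2) n * (1 - k * q ^ (2*n)) = (1 - k) * qpoch (k * q\<^sup>2) (q\<^sup>2) n"
      using qpoch_Suc[of k "q\<^sup>2" n] qpoch_Suc_shift[of k "q\<^sup>2" n] by (simp add: power_mult)
    hence r: "qpoch (k * q\<^sup>2) (q\<^sup>2) n / qpoch k (q\<^sup>2) n = (1 - k * q ^ (2*n)) / (1 - k)"
      using sk0 k1 by (simp add: field_simps)
    have "qpochs [k, q * sk, - q * sk, y, z, q * a / k, k / sa, - k / sa, k * sqa, - k * sqa, x, M] q n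
        = qpoch k q n * (qpoch (q*sk) q n * qpoch (-(q*sk)) q n) * qpoch y q n * qpoch z q n * qpoch (q*a/k) q n
         * ((qpoch (k/sa) q n * qpoch (-(k/sa)) q n) * (qpoch (k*sqa) q n * qpoch (-(k*sqa)) q n))
         * qpoch x q n * qpoch M q n"
      unfolding neg by (simp only: qpochs_def list.map prod_list.Cons prod_list.Nil mult_1_right mult.assoc)
    also have "\<dots> = qpoch k q n * qpoch (k * q\<^sup>2) (q\<^sup>2) n * qpoch y q n * qpoch z q n * qpoch (q*a/k) q n
         * qpoch (k\<^sup>2/a) q (2*n) * qpoch x q n * qpoch M q n"
      unfolding qpoch_sqrt_pair sqs qpoch_double ..
    finally have num: "qpochs [k, q * sk, - q * sk, y, z, q * a / k, k / sa, - k / sa, k * sqa, - k * sqa, x, M] q n = \<dots>" .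
    have "qpochs (q # [sk, - sk, q * k / y, q * k / z, k ^ 2 / a, saq, - saq, q * sa, - q * sa,
            k * q ^ (N + 1), la]) q n
       = qpoch q q n * (qpoch sk q n * qpoch (- sk) q n) * qpoch (k*q/y) q n * qpoch (k*q/z) q n * qpoch (k\<^sup>2/a) q n
         * ((qpoch saq q n * qpoch (- saq) q n) * (qpoch (q*sa) q n * qpoch (-(q*sa)) q n))
         * qpoch (k * q ^ (N + 1)) q n * qpoch la q n"
      unfolding neg com by (simp only: qpochs_def list.map prod_list.Cons prod_list.Nil mult_1_right mult.assoc)
    also have "\<dots> = qpoch q q n * qpoch k (q\<^sup>2) n * qpoch (k*q/y) q n * qpoch (k*q/z) q n * qpoch (k\<^sup>2/a) q n
         * qpoch (a*q) q (2*n) * qpoch (k * q ^ (N + 1)) q n * qpoch la q n"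
      unfolding qpoch_sqrt_pair sqs qpoch_double assms(7,9) ..
    finally have den: "qpochs (q # [sk, - sk, q * k / y, q * k / z, k ^ 2 / a, saq, - saq, q * sa, - q * sa,
            k * q ^ (N + 1), la]) q n = \<dots>" .
    show ?thesis
      unfolding num den W_def \<beta>_def r[symmetric]
      by (simp only: times_divide_times_eq times_divide_eq_left times_divide_eq_right divide_divide_eq_left mult_ac)
  qed
  have rhs: "qpochs [y, z, q * a ^ 2 / k ^ 2, x, M] q r / qpochs (q # [q * a / y, q * a / z, a * q ^ (N + 1), lk]) q r * q ^ r
     = \<alpha> r * Z r" for r
  proof -
    \<comment> \<open>The argument \<open>q\<close> is shared out: \<open>k/a\<close> goes to
      \<open>\<alpha>\<close> and \<open>a*q/k\<close> to \<open>Z\<close>.\<close>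
    have "q ^ r = (k/a) ^ r * (a*q/k) ^ r"
      unfolding power_mult_distrib[symmetric] using nz by simp
    thus ?thesis
      unfolding qpochs_def list.map prod_list.Cons prod_list.Nil com \<alpha>_def Z_def
      by (simp only: times_divide_times_eq times_divide_eq_left times_divide_eq_right divide_divide_eq_left
          mult_1_left mult_1_right mult_ac)
  qed
  have \<beta>: "\<beta> n = (\<Sum>r\<le>n. \<gamma> n r * \<alpha> r)" if "n \<le> N" for n
    unfolding \<beta>_def \<gamma>_def \<alpha>_def
    by (rule wp_bailey_beta[symmetric]) (use nz nd(1,5) aq that qpoch_nonzero_mono in auto)
  \<comment> \<open>With \<open>n = r + m\<close> the inner sum is the shifted Jackson sum. Its
    value separates into \<open>K\<close>, which is free of \<open>r\<close>, and
    \<open>Z r\<close>, so that only the 5-phi-4 series remains.\<close>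
  have js: "(\<Sum>m\<le>N - r. W (r + m) * \<gamma> (r + m) r)
     = K * Z r" if "r \<le> N" for r
  proof -
    have idx: "r + m + r = 2 * r + m" "r + m - r = m" for m by simp_all
    show ?thesis
      unfolding \<gamma>_def W_def K_def Z_def x_def M_def idx
      by (rule jackson_shifted[OF nz k2 nd(1,8,3,4) aq nd3 nd2(1,2) _ that, unfolded lk la, OF _ nd2(3)])
  qed
  have "qhyp [k, q * sk, - q * sk, y, z, q * a / k, k / sa, - k / sa, k * sqa, - k * sqa, x, q powi (- int N)]
           [sk, - sk, q * k / y, q * k / z, k ^ 2 / a, saq, - saq, q * sa, - q * sa, k * q ^ (N + 1), la] q q
     = (\<Sum>n\<le>N. W n * \<beta> n)"
    by (subst qhyp_terminating[where N = N]) (use nz lhs in \<open>simp_all add: qN\<close>)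
  also have "\<dots> = (\<Sum>n\<le>N. \<Sum>r\<le>n. W n * \<gamma> n r * \<alpha> r)"
    by (simp add: \<beta> sum_distrib_left mult.assoc)
  also have "\<dots> = (\<Sum>r\<le>N. (\<Sum>m\<le>N - r. W (r + m) * \<gamma> (r + m) r) * \<alpha> r)"
    unfolding sum_triangle_shift sum_distrib_right ..
  also have "\<dots> = K * (\<Sum>r\<le>N. \<alpha> r * Z r)"
    by (simp add: js sum_distrib_left mult_ac)
  also have "(\<Sum>r\<le>N. \<alpha> r * Z r)
      = qhyp [y, z, q * a ^ 2 / k ^ 2, x, q powi (- int N)] [q * a / y, q * a / z, a * q ^ (N + 1), lk] q q"
    by (subst qhyp_terminating[where N = N]) (use nz in \<open>simp_all only: qN rhs list.set insert_iff simp_thms\<close>)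
  also have "K = qpochs [k * q, k * q / (y * z), a * q / y, a * q / z] q N
           / qpochs [k * q / y, k * q / z, a * q / (y * z), a * q] q N"
    by (simp only: K_def qpochs_def list.map prod_list.Cons prod_list.Nil mult_1_right mult.assoc)
  finally show ?thesis unfolding x_def la_def lk_def .
qed

end
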